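(* Let $p,p'$ be complex numbers such that none of $p,\ p',\ p+p'-1$ is zero or a negative integer. Then for all complex $x,y$, $$\sum_{m,n=0}^\infty\frac{(p',m+n)(p+p'-1,m+n)(-1)^n x^{m+n}}{\left(\frac{p+p'-1}{2},m+n\right)\left(\frac{p+p'}{2},m+n\right)(p,m)(p',n)}L_m^{(p-1)}(y)\,L_n^{(p'-1)}(-y)=\Gamma(p)\,(2\sqrt{xy})^{1-p}J_{p-1}(4\sqrt{xy}).$$
   Context: $(\alpha,n)=\alpha(\alpha+1)\cdots(\alpha+n-1)$ for $n\ge1$ and $(\alpha,0)=1$ (Pochhammer symbol). The Laguerre polynomial is $L_n^{(a)}(x)=\frac{(a+1,n)}{n!}\,{}_1F_1[-n;a+1;x]=\frac{1}{n!}\sum_{k=0}^n\frac{(-n,k)\,(a+1,n)}{(a+1,k)\,k!}x^k$. $J_\nu$ is the Bessel function of the first kind; the expression $(z/2)^{1-p}J_{p-1}(z)$ denotes the even entire function $\sum_{k\ge0}\frac{(-1)^k (z/2)^{2k}}{k!\,\Gamma(p+k)}$ of $z$, so the right-hand side (with $z=4\sqrt{xy}$) does not depend on the choice of the square root. A double series $\sum_{m,n=0}^\infty c_{m,n}x^{m+n}$ is understood as the power series $\sum_{N=0}^\infty\big(\sum_{m+n=N}c_{m,n}\big)x^N$ in $x$. *)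

theory Defs
  imports "HOL-Analysis.Analysis"
begin

definition laguerre :: "nat \<Rightarrow> complex \<Rightarrow> complex \<Rightarrow> complex" where
  "laguerre n a x = 1 / fact n *
     (\<Sum>k\<le>n. pochhammer (- of_nat n) k * pochhammer (a + 1) n
              / (pochhammer (a + 1) k * fact k) * x ^ k)"

text \<open>The Bessel function of the first kind, with the principal branch of the power. At \<open>z = 0\<close>
  the convention \<open>0 powr a = 0\<close> makes the value 0 for every order.\<close>

definition bessel_J :: "complex \<Rightarrow> complex \<Rightarrow> complex" where
  "bessel_J \<nu> z = (z / 2) powr \<nu> *
     (\<Sum>k. (-1) ^ k * (z / 2) ^ (2 * k) * rGamma (\<nu> + of_nat k + 1) / fact k)"

text \<open>The even entire function denoted by \<open>(z / 2)\<^bsup>1 - p\<^esup> J\<^bsub>p - 1\<^esub>(z)\<close>. It has to be given by its series,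
  since the product \<open>(z / 2) powr (1 - p) * bessel_J (p - 1) z\<close> is 0 at \<open>z = 0\<close>; elsewhere the two
  agree by \<open>bessel_J_reduced_eq\<close>.\<close>

definition bessel_J_reduced :: "complex \<Rightarrow> complex \<Rightarrow> complex" where
  "bessel_J_reduced p z =
     (\<Sum>k. (-1) ^ k * (z / 2) ^ (2 * k) / (fact k * Gamma (p + of_nat k)))"

lemma bessel_J_reduced_eq:
  assumes "z \<noteq> 0"
  shows "(z / 2) powr (1 - p) * bessel_J (p - 1) z = bessel_J_reduced p z"
proof -
  have "(z / 2) powr (1 - p) * (z / 2) powr (p - 1) = 1"
    using assms by (simp flip: powr_add)
  then show ?thesis
    by (simp add: bessel_J_def bessel_J_reduced_def rGamma_inverse_Gamma field_simps
        flip: mult.assoc)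
qed

lemma bessel_J_reduced_minus: "bessel_J_reduced p (- z) = bessel_J_reduced p z"
  by (simp add: bessel_J_reduced_def)

end

theory Submission
  imports Defs "HOL-Computational_Algebra.Formal_Power_Series"
begin

text \<open>The generating function of \<open>L\<^sub>m\<^bsup>(p-1)\<^esup>(y) / (p, m)\<close> is
  \<open>e\<^sup>t \<cdot> \<^sub>0F\<^sub>1(p; -y t)\<close>, and that of \<open>(-1)\<^sup>n L\<^sub>n\<^bsup>(p'-1)\<^esup>(-y) / (p', n)\<close> is
  \<open>e\<^bsup>-t\<^esup> \<cdot> \<^sub>0F\<^sub>1(p'; -y t)\<close>. In their product the exponentials cancel, and the
  coefficients of a product of two \<open>\<^sub>0F\<^sub>1\<close> series are given by the Chu--Vandermonde identity. The
  duplication formula for Pochhammer symbols then turns the \<open>N\<close>-th term of the double series into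
  the \<open>N\<close>-th term of the Bessel series.\<close>

unbundle no vec_syntax
unbundle fps_syntax

text \<open>The scale \<open>c\<close> is built into the coefficients, so the series is 0F1(p; c t)
  in \<open>t\<close> and needs no composition.\<close>

definition fps_0F1 :: "complex \<Rightarrow> complex \<Rightarrow> complex fps" where
  "fps_0F1 p c = Abs_fps (\<lambda>k. c ^ k / (pochhammer p k * fact k))"

lemma pochhammer_nonzero:
  fixes z :: "'a :: field_char_0"
  assumes "z \<notin> \<int>\<^sub>\<le>\<^sub>0"
  shows "pochhammer z n \<noteq> 0"
  using assms pochhammer_eq_0_imp_nonpos_Int by blast

text \<open>Over the common denominator (p)_n (q)_n, the quotients (p)_n / (p)_i and (q)_n /
  (q)_(n-i) become generalized binomials whose upper arguments do not depend on \<open>i\<close>, so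
  Vandermonde convolution sums them.\<close>

lemma fps_0F1_mult_nth:
  assumes "p \<notin> \<int>\<^sub>\<le>\<^sub>0" "q \<notin> \<int>\<^sub>\<le>\<^sub>0"
  shows "(fps_0F1 p c * fps_0F1 q c) $ n
    = pochhammer (p + q - 1 + of_nat n) n * c ^ n / (pochhammer p n * pochhammer q n * fact n)"
proof -
  have step: "c ^ i / (pochhammer p i * fact i) * (c ^ (n - i) / (pochhammer q (n - i) * fact (n - i)))
      = c ^ n / (pochhammer p n * pochhammer q n)
        * (((q + of_nat n - 1) gchoose i) * ((p + of_nat n - 1) gchoose (n - i)))"
    if "i \<le> n" for i
  proof -
    have p: "(p + of_nat n - 1) gchoose (n - i) = pochhammer (p + of_nat i) (n - i) / fact (n - i)"
      using that by (simp add: gbinomial_pochhammer' of_nat_diff)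
    have q: "(q + of_nat n - 1) gchoose i = pochhammer (q + of_nat (n - i)) i / fact i"
      using that by (simp add: gbinomial_pochhammer' of_nat_diff algebra_simps)
    have pn: "pochhammer p n = pochhammer p i * pochhammer (p + of_nat i) (n - i)"
      using that by (rule pochhammer_product)
    have qn: "pochhammer q n = pochhammer q (n - i) * pochhammer (q + of_nat (n - i)) i"
      using that pochhammer_product[of "n - i" n q] by simp
    have c: "c ^ n = c ^ i * c ^ (n - i)"
      using that by (simp flip: power_add)
    have "pochhammer (p + of_nat i) (n - i) \<noteq> 0" "pochhammer (q + of_nat (n - i)) i \<noteq> 0"
      using pochhammer_nonzero[OF assms(1), of n] pochhammer_nonzero[OF assms(2), of n] pn qn
      by auto
    then show ?thesis
      unfolding p q pn qn c by (simp add: field_simps)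
  qed
  have "(fps_0F1 p c * fps_0F1 q c) $ n = (\<Sum>i=0..n. c ^ n / (pochhammer p n * pochhammer q n)
        * (((q + of_nat n - 1) gchoose i) * ((p + of_nat n - 1) gchoose (n - i))))"
    unfolding fps_mult_nth fps_0F1_def by (intro sum.cong) (use step in auto)
  also have "\<dots> = c ^ n / (pochhammer p n * pochhammer q n)
        * ((q + of_nat n - 1 + (p + of_nat n - 1)) gchoose n)"
    by (simp only: gbinomial_Vandermonde flip: sum_distrib_left)
  also have "(q + of_nat n - 1 + (p + of_nat n - 1)) gchoose n
        = pochhammer (p + q - 1 + of_nat n) n / fact n"
    by (simp add: gbinomial_pochhammer' algebra_simps)
  finally show ?thesis
    by simp
qed

lemma pochhammer_minus_of_nat:
  assumes "k \<le> n"
  shows "pochhammer (- of_nat n :: 'a :: field_char_0) k = (-1) ^ k * fact n / fact (n - k)"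
proof -
  have "pochhammer (- of_nat n :: 'a) k = (-1) ^ k * pochhammer (of_nat n - of_nat k + 1) k"
    by (rule pochhammer_minus)
  also have "pochhammer (of_nat n - of_nat k + 1 :: 'a) k = pochhammer (1 + of_nat (n - k)) k"
    using assms by (simp add: of_nat_diff add_ac)
  also have "\<dots> = fact n / fact (n - k)"
    using pochhammer_product[of "n - k" n "1 :: 'a"] assms by (simp flip: pochhammer_fact)
  finally show ?thesis
    by simp
qed

text \<open>Since (-n)_k / n! = (-1)^k / (n-k)!, the Laguerre sum is already a Cauchy product with
  the exponential series.\<close>

lemma laguerre_eq_fps_nth:
  assumes "p \<notin> \<int>\<^sub>\<le>\<^sub>0"
  shows "laguerre n (p - 1) y = pochhammer p n * (fps_exp 1 * fps_0F1 p (- y)) $ n"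
proof -
  \<comment> \<open>Swapping the factors makes the convolution index the power of \<open>y\<close>,
    as in \<open>laguerre\<close>.\<close>
  have "(fps_exp 1 * fps_0F1 p (- y)) $ n = (fps_0F1 p (- y) * fps_exp 1) $ n"
    by (simp add: mult.commute)
  also have "\<dots> = (\<Sum>k=0..n. (- y) ^ k / (pochhammer p k * fact k) * (1 / fact (n - k)))"
    by (simp add: fps_mult_nth fps_0F1_def)
  also have "\<dots> = (\<Sum>k\<le>n. (- y) ^ k / (pochhammer p k * fact k) * (1 / fact (n - k)))"
    by (simp add: atMost_atLeast0)
  finally have nth: "(fps_exp 1 * fps_0F1 p (- y)) $ n
      = (\<Sum>k\<le>n. (- y) ^ k / (pochhammer p k * fact k) * (1 / fact (n - k)))" .
  show ?thesis
    unfolding laguerre_def nth sum_distrib_left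
    by (auto intro!: sum.cong simp: pochhammer_minus_of_nat power_minus[of y] field_simps)
qed

text \<open>This is the substitution of -t for t; it yields both the alternating sign and the
  argument \<open>- y\<close> of the second Laguerre factor.\<close>

lemma fps_exp_minus_mult_fps_0F1_nth:
  "(fps_exp (- 1) * fps_0F1 q (- y)) $ n = (- 1) ^ n * (fps_exp 1 * fps_0F1 q y) $ n"
proof -
  have "(- 1) ^ (n - i) * (- y) ^ i = (- 1) ^ n * y ^ i" if "i \<le> n" for i
    using that
    by (metis le_add_diff_inverse2 mult.assoc power_add power_minus)
  then have "(fps_0F1 q (- y) * fps_exp (- 1)) $ n = (- 1) ^ n * (fps_0F1 q y * fps_exp 1) $ n"
    unfolding fps_mult_nth sum_distrib_left
    by (intro sum.cong) (auto simp: fps_0F1_def field_simps)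
  then show ?thesis
    by (simp add: mult.commute)
qed

text \<open>This evaluates the diagonal m + n = N of the double series, freed of the factors that
  depend on N alone.\<close>

lemma sum_laguerre_mult_laguerre:
  assumes "p \<notin> \<int>\<^sub>\<le>\<^sub>0" "q \<notin> \<int>\<^sub>\<le>\<^sub>0"
  shows "(\<Sum>i=0..n. laguerre i (p - 1) y / pochhammer p i
             * ((-1) ^ (n - i) * laguerre (n - i) (q - 1) (- y) / pochhammer q (n - i)))
    = pochhammer (p + q - 1 + of_nat n) n * (- y) ^ n / (pochhammer p n * pochhammer q n * fact n)"
proof -
  have "(\<Sum>i=0..n. laguerre i (p - 1) y / pochhammer p i
             * ((-1) ^ (n - i) * laguerre (n - i) (q - 1) (- y) / pochhammer q (n - i)))
    = ((fps_exp 1 * fps_0F1 p (- y)) * (fps_exp (- 1) * fps_0F1 q (- y))) $ n"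
    unfolding fps_mult_nth[of "fps_exp 1 * fps_0F1 p (- y)"] fps_exp_minus_mult_fps_0F1_nth
    by (simp add: laguerre_eq_fps_nth assms pochhammer_nonzero)
  also have "(fps_exp 1 * fps_0F1 p (- y)) * (fps_exp (- 1) * fps_0F1 q (- y))
      = (fps_exp 1 * fps_exp (- 1)) * (fps_0F1 p (- y) * fps_0F1 q (- y))"
    by (simp add: mult_ac)
  also have "fps_exp 1 * fps_exp (- 1) = (1 :: complex fps)"
    by (simp flip: fps_exp_add_mult)
  finally show ?thesis
    by (simp add: fps_0F1_mult_nth assms)
qed

lemma summable_0F1:
  fixes p c :: complex
  assumes "p \<notin> \<int>\<^sub>\<le>\<^sub>0"
  shows "summable (\<lambda>k. c ^ k / (pochhammer p k * fact k))"
proof -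
  \<comment> \<open>From \<open>M\<close> on, |p + n| \<ge> 1 and 2|c| \<le> n + 1, so the term
    ratio c / ((n+1)(p+n)) has norm at most 1/2.\<close>
  obtain M :: nat where M: "norm p + 1 + 2 * norm c \<le> M"
    using real_arch_simple by blast
  show ?thesis
  proof (rule summable_ratio_test)
    show "(1 / 2 :: real) < 1"
      by simp
  next
    fix n assume "n \<ge> M"
    then have n: "norm p + 1 + 2 * norm c \<le> n"
      using M by linarith
    have "real n - norm p \<le> norm (p + of_nat n)"
      using norm_diff_ineq[of "of_nat n" p] by (simp add: add.commute)
    then have "1 \<le> norm (p + of_nat n)"
      using n norm_ge_zero[of c] by linarith
    moreover have "2 * norm c \<le> 1 + real n"
      using n norm_ge_zero[of p] by linarith
    ultimately have le: "2 * norm c \<le> (1 + real n) * norm (p + of_nat n)"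
      using mult_mono[of "2 * norm c" "1 + real n" 1 "norm (p + of_nat n)"] by simp
    have "p + of_nat n \<noteq> 0"
      using \<open>1 \<le> norm (p + of_nat n)\<close> by auto
    have "c ^ Suc n / (pochhammer p (Suc n) * fact (Suc n))
        = c / ((1 + of_nat n) * (p + of_nat n)) * (c ^ n / (pochhammer p n * fact n))"
      by (simp add: pochhammer_Suc)
    moreover have "norm (c / ((1 + of_nat n) * (p + of_nat n))) \<le> 1 / 2"
    proof -
      have "norm (1 + of_nat n :: complex) = 1 + real n"
        by (metis norm_of_nat of_nat_Suc)
      then show ?thesis
        using le \<open>p + of_nat n \<noteq> 0\<close>
        by (simp add: norm_divide norm_mult divide_le_eq)
    qed
    ultimately show "norm (c ^ Suc n / (pochhammer p (Suc n) * fact (Suc n)))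
        \<le> 1 / 2 * norm (c ^ n / (pochhammer p n * fact n))"
      by (metis norm_mult mult_right_mono norm_ge_zero)
  qed
qed

text \<open>Because Gamma(p+k) = Gamma(p) (p)_k, the normalized Bessel series is 0F1(p;
  -(z/2)^2).\<close>

lemma bessel_J_reduced_sums:
  assumes "p \<notin> \<int>\<^sub>\<le>\<^sub>0"
  shows "(\<lambda>k. (- ((z / 2)\<^sup>2)) ^ k / (pochhammer p k * fact k)) sums (Gamma p * bessel_J_reduced p z)"
proof -
  have "Gamma p \<noteq> 0"
    using assms by (simp add: Gamma_eq_zero_iff)
  then have "(- 1) ^ k * (z / 2) ^ (2 * k) / (fact k * Gamma (p + of_nat k))
      = 1 / Gamma p * ((- ((z / 2)\<^sup>2)) ^ k / (pochhammer p k * fact k))" for k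
    using assms
    by (simp add: pochhammer_Gamma power_mult power_minus[of "(z / 2)\<^sup>2"])
  then have "Gamma p * bessel_J_reduced p z = (\<Sum>k. (- ((z / 2)\<^sup>2)) ^ k / (pochhammer p k * fact k))"
    using \<open>Gamma p \<noteq> 0\<close> suminf_mult[OF summable_0F1[OF assms], of "1 / Gamma p"]
    unfolding bessel_J_reduced_def by simp
  then show ?thesis
    using summable_sums[OF summable_0F1[OF assms]] by simp
qed

theorem mainTheorem2:
  fixes p p' x y :: complex
  assumes "p \<notin> \<int>\<^sub>\<le>\<^sub>0" and "p' \<notin> \<int>\<^sub>\<le>\<^sub>0" and "p + p' - 1 \<notin> \<int>\<^sub>\<le>\<^sub>0"
  shows "(\<lambda>N. \<Sum>(m, n)\<in>{(m, n). m + n = N}.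
            pochhammer p' (m + n) * pochhammer (p + p' - 1) (m + n) * (-1) ^ n * x ^ (m + n)
              / (pochhammer ((p + p' - 1) / 2) (m + n) * pochhammer ((p + p') / 2) (m + n)
                   * pochhammer p m * pochhammer p' n)
              * laguerre m (p - 1) y * laguerre n (p' - 1) (- y))
         sums (Gamma p * bessel_J_reduced p (4 * csqrt (x * y)))"
proof -
  \<comment> \<open>Both sides agree term by term in \<open>N\<close>, so convergence is inherited
    from the Bessel series.\<close>
  have coeff: "(\<Sum>(m, n)\<in>{(m, n). m + n = N}.
            pochhammer p' (m + n) * pochhammer (p + p' - 1) (m + n) * (-1) ^ n * x ^ (m + n)
              / (pochhammer ((p + p' - 1) / 2) (m + n) * pochhammer ((p + p') / 2) (m + n)
                   * pochhammer p m * pochhammer p' n)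
              * laguerre m (p - 1) y * laguerre n (p' - 1) (- y))
      = (- (4 * (x * y))) ^ N / (pochhammer p N * fact N)" (is "?S = _") for N
  proof -
    define P where "P = p + p' - 1"
    define D where "D = pochhammer (P / 2) N * pochhammer ((p + p') / 2) N"
    have half: "(p + p') / 2 = P / 2 + 1 / 2"
      by (simp add: P_def field_simps)
    have double: "pochhammer P (2 * N) = 4 ^ N * D"
      unfolding D_def half using pochhammer_double[of "P / 2" N] by (simp add: power_mult)
    \<comment> \<open>By duplication, a zero of \<open>D\<close> would be a zero of (P)_(2N), which
      the third hypothesis excludes.\<close>
    have "D \<noteq> 0"
      using double pochhammer_nonzero[OF assms(3), of "2 * N"] by (auto simp: P_def)
    \<comment> \<open>The first factor stands in the numerator of the double series, the second
      comes from Chu-Vandermonde; together they cancel \<open>D\<close> and leave 4^N.\<close>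
    have split: "pochhammer P N * pochhammer (P + of_nat N) N = 4 ^ N * D"
      using pochhammer_product'[of P N N] double by (simp add: mult_2)
    have "?S = (\<Sum>i=0..N. pochhammer p' N * pochhammer P N * x ^ N / D
            * (laguerre i (p - 1) y / pochhammer p i
             * ((-1) ^ (N - i) * laguerre (N - i) (p' - 1) (- y) / pochhammer p' (N - i))))"
      by (intro sum.reindex_bij_witness[of _ "\<lambda>i. (i, N - i)" fst]) (auto simp: D_def P_def mult_ac)
    also have "\<dots> = pochhammer p' N * pochhammer P N * x ^ N / D
        * (pochhammer (P + of_nat N) N * (- y) ^ N / (pochhammer p N * pochhammer p' N * fact N))"
      unfolding P_def sum_laguerre_mult_laguerre[OF assms(1,2), symmetric] sum_distrib_left ..
    also have "\<dots> = (pochhammer P N * pochhammer (P + of_nat N) N) * (x ^ N * (- y) ^ N)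
        / (D * (pochhammer p N * fact N))"
      using pochhammer_nonzero[OF assms(2), of N] by simp
    also have "\<dots> = (- (4 * (x * y))) ^ N / (pochhammer p N * fact N)"
      unfolding split using \<open>D \<noteq> 0\<close>
      by (simp flip: power_mult_distrib)
    finally show ?thesis .
  qed
  \<comment> \<open>Only the square of the root enters, so the branch of \<open>csqrt\<close> is
    immaterial.\<close>
  have arg: "(4 * csqrt (x * y) / 2)\<^sup>2 = 4 * (x * y)"
    by (simp add: power_divide power_mult_distrib)
  show ?thesis
    unfolding coeff using bessel_J_reduced_sums[OF assms(1), of "4 * csqrt (x * y)"]
    unfolding arg .
qed

end
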